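(* Let $D=(V,\mathcal A)$ be a strongly connected, locally finite, simple directed graph. Let $(x,y)\in\mathcal A$ be an arc such that $d^{\rm out}_x=d^{\rm out}_y=r$. Then the Lin--Lu--Yau Ricci curvature $\kappa(x,y)$ is given by $$\kappa(x,y)=\begin{cases}1-\dfrac1r\displaystyle\sum_{v\in N^{\rm out}(x)}d(v,w(v)), & \text{if } x\notin N^{\rm out}(y),\\[12pt] 1-\dfrac1r\left(\displaystyle\sum_{v\in N^{\rm out}(x)\setminus\{y\}}d(v,w(v))-1\right), & \text{if } x\in N^{\rm out}(y).\end{cases}$$ Here, if $x\notin N^{\rm out}(y)$, $w:N^{\rm out}(x)\to N^{\rm out}(y)$ is a bijection for which $\sum_{v\in N^{\rm out}(x)}d(v,w(v))$ is minimum among all bijections $N^{\rm out}(x)\to N^{\rm out}(y)$; if $x\in N^{\rm out}(y)$, $w:N^{\rm out}(x)\to N^{\rm out}(y)$ is a bijection with $w(y)=x$ for which $\sum_{v\in N^{\rm out}(x)\setminus\{y\}}d(v,w(v))$ is minimum among all bijections $N^{\rm out}(x)\to N^{\rm out}(y)$ sending $y$ to $x$.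
   Context: A directed graph $D=(V,\mathcal A)$ is simple if it has no loops and no multiple arcs (opposite arcs $(x,y)$ and $(y,x)$ may both be present). $N^{\rm out}(x)=\{v\in V:(x,v)\in\mathcal A\}$ and $d^{\rm out}_x=|N^{\rm out}(x)|$; $D$ is locally finite if every $d_x^{\rm out}$ is finite. $d(x,y)$ is the length of a shortest directed path from $x$ to $y$ (not symmetric in general); $D$ is strongly connected if $d(x,y)<\infty$ for all $x,y$. For $\alpha\in[0,1]$, the $\alpha$-lazy random walk measure at $x$ is $\mu^\alpha_x(x)=\alpha$, $\mu^\alpha_x(v)=\frac{1-\alpha}{d^{\rm out}_x}$ if $(x,v)\in\mathcal A$, and $\mu_x^\alpha(v)=0$ otherwise. For probability measures $\mu,\nu$ on $V$, $W(\mu,\nu)=\inf_A\sum_{u,v\in V}A(u,v)d(u,v)$, the infimum over couplings $A:V\times V\to[0,1]$ with $\sum_{v}A(u,v)=\mu(u)$ for all $u$ and $\sum_uA(u,v)=\nu(v)$ for all $v$. For distinct $x,y$, $\kappa_\alpha(x,y)=1-\frac{W(\mu_x^\alpha,\mu_y^\alpha)}{d(x,y)}$, and the Lin--Lu--Yau Ricci curvature is $\kappa(x,y)=\lim_{\alpha\to1^-}\frac{\kappa_\alpha(x,y)}{1-\alpha}$. *)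

theory Defs
  imports
    "HOL-Analysis.Infinite_Sum"
    "Graph_Theory.Pair_Digraph"
    "Graph_Theory.Digraph_Component"
    "Graph_Theory.Shortest_Path"
begin

text \<open>
  A digraph is a \<^typ>\<open>'a pair_pre_digraph\<close>: a vertex set together with a set of ordered pairs, so
  multiple arcs are excluded by the representation. Absence of loops is
  \<^locale>\<open>pair_loopfree_digraph\<close>, which also contains well-formedness; neither finiteness nor
  symmetry is included.
\<close>

definition out_nbrs :: "'a pair_pre_digraph \<Rightarrow> 'a \<Rightarrow> 'a set" where
  "out_nbrs D x = {v \<in> pverts D. (x, v) \<in> parcs D}"

definition out_deg :: "'a pair_pre_digraph \<Rightarrow> 'a \<Rightarrow> nat" where
  "out_deg D x = card (out_nbrs D x)"

definition locally_finite :: "'a pair_pre_digraph \<Rightarrow> bool" where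
  "locally_finite D \<longleftrightarrow> (\<forall>x \<in> pverts D. finite (out_nbrs D x))"

text \<open>
  With unit arc weights the cost of a walk is its number of arcs, so this is the length of a
  shortest directed path, and \<open>\<infinity>\<close> if there is none.
\<close>
definition digraph_dist :: "'a pair_pre_digraph \<Rightarrow> 'a \<Rightarrow> 'a \<Rightarrow> ereal" where
  "digraph_dist D u v = wf_digraph.\<mu> (with_proj D) (\<lambda>_. 1) u v"

definition lazy_walk :: "'a pair_pre_digraph \<Rightarrow> real \<Rightarrow> 'a \<Rightarrow> 'a \<Rightarrow> real" where
  "lazy_walk D \<alpha> x v =
     (if v = x then \<alpha>
      else if (x, v) \<in> parcs D then (1 - \<alpha>) / real (out_deg D x)
      else 0)"

definition couplings ::
  "'a pair_pre_digraph \<Rightarrow> ('a \<Rightarrow> real) \<Rightarrow> ('a \<Rightarrow> real) \<Rightarrow> ('a \<Rightarrow> 'a \<Rightarrow> real) set" where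
  "couplings D \<mu> \<nu> =
     {A. (\<forall>u \<in> pverts D. \<forall>v \<in> pverts D. A u v \<in> {0..1}) \<and>
         (\<forall>u \<in> pverts D. ((\<lambda>v. A u v) has_sum \<mu> u) (pverts D)) \<and>
         (\<forall>v \<in> pverts D. ((\<lambda>u. A u v) has_sum \<nu> v) (pverts D))}"

text \<open>
  The transport cost is summed in \<^typ>\<open>ereal\<close>, where a sum of nonnegative terms always
  exists; a real-valued \<^const>\<open>infsum\<close> would return \<open>0\<close> for a divergent cost.
\<close>
definition wasserstein :: "'a pair_pre_digraph \<Rightarrow> ('a \<Rightarrow> real) \<Rightarrow> ('a \<Rightarrow> real) \<Rightarrow> ereal" where
  "wasserstein D \<mu> \<nu> =
     (INF A \<in> couplings D \<mu> \<nu>.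
        \<Sum>\<^sub>\<infinity>(u, v) \<in> pverts D \<times> pverts D. ereal (A u v) * digraph_dist D u v)"

definition lazy_curvature :: "'a pair_pre_digraph \<Rightarrow> real \<Rightarrow> 'a \<Rightarrow> 'a \<Rightarrow> ereal" where
  "lazy_curvature D \<alpha> x y =
     1 - wasserstein D (lazy_walk D \<alpha> x) (lazy_walk D \<alpha> y) / digraph_dist D x y"

definition lly_curvature :: "'a pair_pre_digraph \<Rightarrow> 'a \<Rightarrow> 'a \<Rightarrow> ereal" where
  "lly_curvature D x y = Lim (at_left 1) (\<lambda>\<alpha>. lazy_curvature D \<alpha> x y / ereal (1 - \<alpha>))"

end

theory Submission
  imports Defs "HOL-Combinatorics.Cycles"
begin

text \<open>
  For \<open>\<alpha>\<close> close to \<open>1\<close> the transport cost is computed exactly, by matching an explicit coupling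
  with a dual potential. The coupling moves the bulk from \<open>x\<close> to \<open>y\<close> and transports the remaining
  mass along an optimal assignment \<open>w\<close>. For the dual side, optimality of \<open>w\<close> means that no
  permutation of the targets lowers its cost, so shortest paths yield a \<open>1\<close>-Lipschitz \<open>f\<close> with
  \<open>f (w v) - f v = d(v, w v)\<close>. Replacing \<open>f\<close> by \<open>min f (f y - 1 + d(x, \<cdot>))\<close> enforces
  \<open>f y = f x + 1\<close>; this does not lower the dual value, because \<open>f\<close> changes on an out-neighbour of
  \<open>y\<close> only if that vertex is also an out-neighbour of \<open>x\<close>.
\<close>

section \<open>Path costs, potentials and optimal assignments\<close>

definition path_cost :: "('i \<Rightarrow> 'i \<Rightarrow> real) \<Rightarrow> 'i list \<Rightarrow> real" where
  "path_cost c p = sum_list (map2 c p (tl p))"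

lemma path_cost_single [simp]: "path_cost c [i] = 0"
  by (simp add: path_cost_def)

lemma path_cost_Cons_Cons [simp]: "path_cost c (i # j # p) = c i j + path_cost c (j # p)"
  by (simp add: path_cost_def)

lemma path_cost_split: "path_cost c (p @ j # q) = path_cost c (p @ [j]) + path_cost c (j # q)"
proof (induction p)
  case (Cons i p)
  then show ?case by (cases p) auto
qed simp

lemma path_cost_snoc: "p \<noteq> [] \<Longrightarrow> path_cost c (p @ [j]) = path_cost c p + c (last p) j"
proof (induction p)
  case (Cons i p)
  then show ?case by (cases p) auto
qed simp

lemma sum_list_closed_path:
  "sum_list (map2 c (i # p) (p @ [j])) = path_cost c (i # p) + c (last (i # p)) j"
proof (induction p arbitrary: i)
  case (Cons k p)
  then show ?case by auto
qed simp

text \<open>A simple closed path is a cycle of a permutation that fixes the rest of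
  \<open>I\<close>, where the zero diagonal contributes nothing. So the condition on permutations
  rules out negative cycles.\<close>

lemma closed_path_cost_nonneg:
  assumes "finite I" and diag: "\<And>i. i \<in> I \<Longrightarrow> c i i = 0"
    and perm: "\<And>\<pi>. \<pi> permutes I \<Longrightarrow> 0 \<le> (\<Sum>i\<in>I. c i (\<pi> i))"
    and p: "distinct (j # p)" "set (j # p) \<subseteq> I"
  shows "0 \<le> path_cost c (j # p) + c (last (j # p)) j"
proof -
  define \<pi> where "\<pi> = cycle_of_list (j # p)"
  have "\<pi> permutes set (j # p)"
    unfolding \<pi>_def by (rule cycle_permutes)
  then have "\<pi> permutes I"
    using p(2) by (rule permutes_subset)
  \<comment> \<open>Applying the cycle to its own list rotates it by one, which pairs each vertex
    with its successor and the last one with \<open>j\<close>.\<close>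
  have "map \<pi> (j # p) = p @ [j]"
    using cyclic_rotation[OF p(1), of 1] by (simp add: \<pi>_def)
  then have "path_cost c (j # p) + c (last (j # p)) j = sum_list (map2 c (j # p) (map \<pi> (j # p)))"
    by (metis sum_list_closed_path)
  also have "\<dots> = sum_list (map (\<lambda>i. c i (\<pi> i)) (j # p))"
    by (simp add: zip_map2 zip_same_conv_map o_def)
  also have "\<dots> = (\<Sum>i\<in>set (j # p). c i (\<pi> i))"
    using p(1) by (rule sum_list_distinct_conv_sum_set)
  also have "\<dots> = (\<Sum>i\<in>I. c i (\<pi> i))"
    using p(2) \<open>finite I\<close> diag \<open>\<pi> permutes set (j # p)\<close>
    by (intro sum.mono_neutral_left) (auto dest: permutes_not_in)
  finally show ?thesis
    using perm[OF \<open>\<pi> permutes I\<close>] by simp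
qed

text \<open>The potential of \<open>j\<close> is the cost of a cheapest simple path ending in \<open>j\<close>.\<close>
lemma exists_potential:
  fixes c :: "'i \<Rightarrow> 'i \<Rightarrow> real"
  assumes "finite I" and diag: "\<And>i. i \<in> I \<Longrightarrow> c i i = 0"
    and perm: "\<And>\<pi>. \<pi> permutes I \<Longrightarrow> 0 \<le> (\<Sum>i\<in>I. c i (\<pi> i))"
  shows "\<exists>\<phi>. \<forall>i\<in>I. \<forall>j\<in>I. \<phi> j \<le> \<phi> i + c i j"
proof -
  define P where "P j = {p. distinct p \<and> p \<noteq> [] \<and> set p \<subseteq> I \<and> last p = j}" for j
  define \<phi> where "\<phi> j = Min (path_cost c ` P j)" for j
  have fin: "finite (path_cost c ` P j)" for j
    by (rule finite_imageI, rule finite_subset[OF _ finite_subset_distinct[OF \<open>finite I\<close>]])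
       (auto simp: P_def)
  have le: "\<phi> j \<le> path_cost c p" if "p \<in> P j" for p j
    unfolding \<phi>_def using fin that by (intro Min_le) auto
  have "\<phi> j \<le> \<phi> i + c i j" if "i \<in> I" "j \<in> I" for i j
  proof -
    have "[i] \<in> P i"
      using that by (simp add: P_def)
    then have "\<phi> i \<in> path_cost c ` P i"
      unfolding \<phi>_def using fin by (intro Min_in) auto
    then obtain p where p: "p \<in> P i" "\<phi> i = path_cost c p"
      by auto
    show ?thesis
    proof (cases "j \<in> set p")
      case False
      then have "p @ [j] \<in> P j"
        using p that by (auto simp: P_def)
      then have "\<phi> j \<le> path_cost c (p @ [j])"
        by (rule le)
      also have "\<dots> = \<phi> i + c i j"
        using path_cost_snoc[of p c j] p by (simp add: P_def)
      finally show ?thesis .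
    next
      case True
      \<comment> \<open>Cutting at \<open>j\<close> leaves a path \<open>q @ [j]\<close> that
        competes for \<open>\<phi> j\<close>. The remainder \<open>j # s\<close> runs from
        \<open>j\<close> to \<open>i\<close>, and the step back to \<open>j\<close> closes it into a
        cycle of nonnegative cost.\<close>
      then obtain q s where p_eq: "p = q @ j # s"
        by (auto dest: split_list)
      then have "q @ [j] \<in> P j" "distinct (j # s)" "set (j # s) \<subseteq> I" "last (j # s) = i"
        using p(1) by (auto simp: P_def)
      have "\<phi> j \<le> path_cost c (q @ [j])"
        using \<open>q @ [j] \<in> P j\<close> by (rule le)
      moreover have "0 \<le> path_cost c (j # s) + c i j"
        using closed_path_cost_nonneg[of I c j s, OF assms \<open>distinct (j # s)\<close> \<open>set (j # s) \<subseteq> I\<close>]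
        unfolding \<open>last (j # s) = i\<close> .
      ultimately show ?thesis
        using p(2) path_cost_split[of c q j s] by (simp add: p_eq)
    qed
  qed
  then show ?thesis by blast
qed

text \<open>This is complementary slackness for the assignment problem. Composing \<open>w\<close>
  with a permutation of \<open>S\<close> gives another bijection, so optimality excludes negative
  cycles for the cost of rerouting, and the resulting potential on \<open>S\<close> extends to
  \<open>V\<close>.\<close>

lemma optimal_assignment_potential:
  fixes d :: "'a \<Rightarrow> 'a \<Rightarrow> real"
  assumes "finite S" and SV: "S \<subseteq> V" "T \<subseteq> V"
    and tri: "\<And>u v z. u \<in> V \<Longrightarrow> v \<in> V \<Longrightarrow> z \<in> V \<Longrightarrow> d u z \<le> d u v + d v z"
    and nonneg: "\<And>u v. 0 \<le> d u v"
    and refl: "\<And>v. v \<in> V \<Longrightarrow> d v v = 0"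
    and w: "bij_betw w S T"
    and opt: "\<And>w'. bij_betw w' S T \<Longrightarrow> (\<Sum>v\<in>S. d v (w v)) \<le> (\<Sum>v\<in>S. d v (w' v))"
  obtains f where "\<And>u v. u \<in> V \<Longrightarrow> v \<in> V \<Longrightarrow> f v \<le> f u + d u v"
    and "\<And>s. s \<in> S \<Longrightarrow> d s (w s) \<le> f (w s) - f s"
proof (cases "S = {}")
  \<comment> \<open>Separated because the \<open>Min\<close> defining \<open>f\<close> below needs a
    nonempty index set.\<close>
  case True
  then show ?thesis
    using nonneg by (intro that[of "\<lambda>_. 0"]) auto
next
  case False
  \<comment> \<open>The extra cost of sending \<open>i\<close> to the target of \<open>j\<close>
    instead of its own.\<close>
  define c where "c i j = d i (w j) - d i (w i)" for i j
  have "\<exists>\<phi>. \<forall>i\<in>S. \<forall>j\<in>S. \<phi> j \<le> \<phi> i + c i j"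
  proof (rule exists_potential[OF \<open>finite S\<close>])
    show "c i i = 0" for i
      by (simp add: c_def)
    show "0 \<le> (\<Sum>i\<in>S. c i (\<pi> i))" if "\<pi> permutes S" for \<pi>
      using opt[OF bij_betw_trans[OF permutes_imp_bij[OF that] w]]
      by (simp add: c_def sum_subtractf)
  qed
  then obtain \<phi> where \<phi>: "\<phi> j \<le> \<phi> i + c i j" if "i \<in> S" "j \<in> S" for i j
    by blast
  \<comment> \<open>A McShane-type extension: the term of \<open>i\<close> takes the value
    \<open>\<phi> i\<close> at \<open>w i\<close> and grows with the distance from \<open>i\<close>.
    A minimum of such terms is \<open>1\<close>-Lipschitz by the triangle inequality.\<close>
  define f where "f v = Min ((\<lambda>i. \<phi> i - d i (w i) + d i v) ` S)" for v
  have f_le: "f v \<le> \<phi> i - d i (w i) + d i v" if "i \<in> S" for i v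
    unfolding f_def using \<open>finite S\<close> that by (intro Min_le) auto
  have f_attained: "\<exists>i\<in>S. f v = \<phi> i - d i (w i) + d i v" for v
  proof -
    have "f v \<in> (\<lambda>i. \<phi> i - d i (w i) + d i v) ` S"
      unfolding f_def using \<open>finite S\<close> False by (intro Min_in) auto
    then show ?thesis by auto
  qed
  show ?thesis
  proof (rule that)
    fix u v assume uv: "u \<in> V" "v \<in> V"
    obtain i where i: "i \<in> S" "f u = \<phi> i - d i (w i) + d i u"
      using f_attained by blast
    then have "d i v \<le> d i u + d u v"
      using uv SV by (intro tri) auto
    then show "f v \<le> f u + d u v"
      using f_le[of i v] i by simp
  next
    fix s assume s: "s \<in> S"
    obtain i where i: "i \<in> S" "f (w s) = \<phi> i - d i (w i) + d i (w s)"
      using f_attained by blast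
    then have "\<phi> s \<le> f (w s)"
      using \<phi>[of i s] s by (simp add: c_def)
    moreover have "f s \<le> \<phi> s - d s (w s)"
      using f_le[of s s] refl[of s] s SV by auto
    ultimately show "d s (w s) \<le> f (w s) - f s"
      by simp
  qed
qed

lemma sum_of_bool_mem:
  fixes f :: "'b \<Rightarrow> real"
  assumes "finite F" "S \<subseteq> F"
  shows "(\<Sum>v\<in>F. of_bool (v \<in> S) * f v) = (\<Sum>v\<in>S. f v)"
proof -
  have "(\<Sum>v\<in>F. of_bool (v \<in> S) * f v) = (\<Sum>v\<in>S. of_bool (v \<in> S) * f v)"
    using assms by (intro sum.mono_neutral_right) auto
  then show ?thesis by simp
qed

lemma sum_of_bool_eq:
  fixes f :: "'b \<Rightarrow> real"
  assumes "finite F" "z \<in> F"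
  shows "(\<Sum>v\<in>F. of_bool (v = z) * f v) = f z"
  using sum_of_bool_mem[of F "{z}" f] assms by simp

section \<open>Distances in a strongly connected digraph\<close>

locale strong_digraph = pair_loopfree_digraph D for D :: "'a pair_pre_digraph" +
  assumes strong: "strongly_connected (with_proj D)"
    and loc_fin: "locally_finite D"
begin

text \<open>A finite counterpart of \<open>digraph_dist\<close>: strong connectivity supplies a walk
  between any two vertices. Natural values make "distance at least 2" the negation of "distance at
  most 1".\<close>

definition gdist :: "'a \<Rightarrow> 'a \<Rightarrow> nat" where
  "gdist u v = (LEAST n. \<exists>p. awalk u p v \<and> length p = n)"

lemma gdist_le_length: "awalk u p v \<Longrightarrow> gdist u v \<le> length p"
  unfolding gdist_def by (rule Least_le) auto

lemma gdist_attained: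
  assumes "u \<in> pverts D" "v \<in> pverts D"
  obtains p where "awalk u p v" "length p = gdist u v"
proof -
  have "\<exists>p. awalk u p v"
    using strong assms by (auto simp: strongly_connected_def reachable_awalk)
  then have "\<exists>p. awalk u p v \<and> length p = gdist u v"
    unfolding gdist_def by - (rule LeastI_ex, blast)
  then show ?thesis
    using that by blast
qed

lemma awalk_cost_unit: "awalk_cost (\<lambda>_. 1) p = real (length p)"
  by (induction p) auto

lemma digraph_dist_eq:
  assumes "u \<in> pverts D" "v \<in> pverts D"
  shows "digraph_dist D u v = ereal (real (gdist u v))"
  unfolding digraph_dist_def \<mu>_def awalk_cost_unit
proof (rule INF_eqI)
  obtain p where p: "awalk u p v" "length p = gdist u v"
    using assms by (rule gdist_attained)
  show "y \<le> ereal (real (gdist u v))"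
    if "\<And>p. p \<in> {p. awalk u p v} \<Longrightarrow> y \<le> ereal (real (length p))" for y
    using that[of p] p by simp
qed (auto dest: gdist_le_length)

lemma gdist_self [simp]: "u \<in> pverts D \<Longrightarrow> gdist u u = 0"
  using gdist_le_length[of u "[]" u] by (simp add: awalk_Nil_iff)

lemma gdist_triangle:
  assumes "u \<in> pverts D" "v \<in> pverts D" "z \<in> pverts D"
  shows "gdist u z \<le> gdist u v + gdist v z"
proof -
  obtain p q where "awalk u p v" "length p = gdist u v" "awalk v q z" "length q = gdist v z"
    using assms by (metis gdist_attained)
  then show ?thesis
    using gdist_le_length[OF awalk_appendI, of u p v q z] by simp
qed

lemma gdist_eq_0_imp_eq:
  assumes "u \<in> pverts D" "v \<in> pverts D" "gdist u v = 0"
  shows "u = v"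
  using assms by (metis awalk_Nil_iff gdist_attained length_0_conv)

lemma gdist_le_1_imp_arc:
  assumes "u \<in> pverts D" "v \<in> pverts D" "u \<noteq> v" "gdist u v \<le> 1"
  shows "(u, v) \<in> parcs D"
proof -
  obtain p where p: "awalk u p v" "length p = gdist u v"
    using assms gdist_attained by blast
  moreover have "length p \<noteq> 0"
    using p gdist_eq_0_imp_eq assms by metis
  ultimately have "length p = 1"
    using assms(4) by linarith
  then obtain e where "p = [e]"
    by (auto simp: length_Suc_conv)
  then show ?thesis
    using p by (auto simp: awalk_Cons_iff awalk_Nil_iff)
qed

lemma gdist_arc:
  assumes "(u, v) \<in> parcs D"
  shows "gdist u v = 1"
proof -
  have uv: "u \<in> pverts D" "v \<in> pverts D" "u \<noteq> v"
    using assms in_arcsD1 in_arcsD2 pair_no_loops by fastforce+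
  then have "awalk u [(u, v)] v"
    using assms by (simp add: awalk_Cons_iff awalk_Nil_iff)
  then have "gdist u v \<le> 1"
    by (auto dest: gdist_le_length)
  then show ?thesis
    using gdist_eq_0_imp_eq[of u v] uv by linarith
qed

lemma mem_out_nbrs: "v \<in> out_nbrs D u \<longleftrightarrow> (u, v) \<in> parcs D"
  by (auto simp: out_nbrs_def dest: in_arcsD2)

lemma out_nbrs_subset: "out_nbrs D u \<subseteq> pverts D"
  by (auto simp: out_nbrs_def)

lemma finite_out_nbrs: "u \<in> pverts D \<Longrightarrow> finite (out_nbrs D u)"
  using loc_fin by (simp add: locally_finite_def)

lemma not_mem_out_nbrs_self [simp]: "u \<notin> out_nbrs D u"
  using pair_no_loops by (fastforce simp: mem_out_nbrs)

section \<open>Transport between finitely supported measures\<close>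

lemma coupling_cost_eq:
  assumes "finite F" "F \<subseteq> pverts D"
    and zero: "\<And>u v. u \<in> pverts D \<Longrightarrow> v \<in> pverts D \<Longrightarrow> \<not> (u \<in> F \<and> v \<in> F) \<Longrightarrow> A u v = 0"
  shows "(\<Sum>\<^sub>\<infinity>(u, v) \<in> pverts D \<times> pverts D. ereal (A u v) * digraph_dist D u v) =
    ereal (\<Sum>u\<in>F. \<Sum>v\<in>F. A u v * gdist u v)"
proof -
  have "(\<Sum>\<^sub>\<infinity>(u, v) \<in> pverts D \<times> pverts D. ereal (A u v) * digraph_dist D u v) =
      (\<Sum>\<^sub>\<infinity>(u, v) \<in> F \<times> F. ereal (A u v * gdist u v))"
  proof (intro infsum_cong_neutral)
    fix e assume "e \<in> pverts D \<times> pverts D - F \<times> F"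
    then show "(case e of (u, v) \<Rightarrow> ereal (A u v) * digraph_dist D u v) = 0"
      using zero by (cases e) auto
  next
    fix e assume "e \<in> (pverts D \<times> pverts D) \<inter> F \<times> F"
    then show "(case e of (u, v) \<Rightarrow> ereal (A u v) * digraph_dist D u v) =
        (case e of (u, v) \<Rightarrow> ereal (A u v * gdist u v))"
      by (auto simp: digraph_dist_eq)
  qed (use assms(2) in auto)
  also have "\<dots> = (\<Sum>(u, v) \<in> F \<times> F. ereal (A u v * gdist u v))"
    using \<open>finite F\<close> by simp
  also have "\<dots> = ereal (\<Sum>u\<in>F. \<Sum>v\<in>F. A u v * gdist u v)"
    by (simp add: sum.cartesian_product split_def)
  finally show ?thesis .
qed

text \<open>Weak Kantorovich duality. Every coupling vanishes off \<open>F \<times> F\<close>, so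
  the infinite sums become finite and may be interchanged.\<close>

lemma wasserstein_ge_dual:
  fixes f :: "'a \<Rightarrow> real"
  assumes "finite F" "F \<subseteq> pverts D"
    and \<mu>0: "\<And>u. u \<in> pverts D - F \<Longrightarrow> m u = 0" and \<nu>0: "\<And>v. v \<in> pverts D - F \<Longrightarrow> n v = 0"
    and lip: "\<And>u v. u \<in> pverts D \<Longrightarrow> v \<in> pverts D \<Longrightarrow> f v \<le> f u + gdist u v"
  shows "ereal ((\<Sum>v\<in>F. n v * f v) - (\<Sum>u\<in>F. m u * f u)) \<le> wasserstein D m n"
  unfolding wasserstein_def
proof (rule INF_greatest)
  fix A assume "A \<in> couplings D m n"
  then have nonneg: "\<forall>u\<in>pverts D. \<forall>v\<in>pverts D. 0 \<le> A u v"
    and rows: "\<forall>u\<in>pverts D. ((\<lambda>v. A u v) has_sum m u) (pverts D)"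
    and cols: "\<forall>v\<in>pverts D. ((\<lambda>u. A u v) has_sum n v) (pverts D)"
    by (simp_all add: couplings_def)
  \<comment> \<open>Nonnegative entries of a row or column with total \<open>0\<close> all
    vanish.\<close>
  have zero: "A u v = 0" if "u \<in> pverts D" "v \<in> pverts D" "\<not> (u \<in> F \<and> v \<in> F)" for u v
  proof (cases "u \<in> F")
    case True
    then have "((\<lambda>u. A u v) has_sum 0) (pverts D)"
      using bspec[OF cols that(2)] \<nu>0[of v] that by simp
    then show ?thesis
      by (rule nonneg_has_sum_le_0D) (use nonneg that in auto)
  next
    case False
    then have "((\<lambda>v. A u v) has_sum 0) (pverts D)"
      using bspec[OF rows that(1)] \<mu>0[of u] that by simp
    then show ?thesis
      by (rule nonneg_has_sum_le_0D) (use nonneg that in auto)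
  qed
  have row_sum: "(\<Sum>v\<in>F. A u v) = m u" if "u \<in> F" for u
  proof -
    have "u \<in> pverts D"
      using that assms(2) by auto
    then have "((\<lambda>v. A u v) has_sum (\<Sum>v\<in>F. A u v)) (pverts D)"
      using assms(1,2) zero by (intro has_sum_finite_neutralI[of F]) auto
    with bspec[OF rows \<open>u \<in> pverts D\<close>] show ?thesis
      using has_sum_unique by blast
  qed
  have col_sum: "(\<Sum>u\<in>F. A u v) = n v" if "v \<in> F" for v
  proof -
    have "v \<in> pverts D"
      using that assms(2) by auto
    then have "((\<lambda>u. A u v) has_sum (\<Sum>u\<in>F. A u v)) (pverts D)"
      using assms(1,2) zero by (intro has_sum_finite_neutralI[of F]) auto
    with bspec[OF cols \<open>v \<in> pverts D\<close>] show ?thesis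
      using has_sum_unique by blast
  qed
  have "(\<Sum>v\<in>F. n v * f v) - (\<Sum>u\<in>F. m u * f u) =
      (\<Sum>v\<in>F. \<Sum>u\<in>F. A u v * f v) - (\<Sum>u\<in>F. \<Sum>v\<in>F. A u v * f u)"
    by (simp flip: row_sum col_sum add: sum_distrib_right)
  also have "(\<Sum>v\<in>F. \<Sum>u\<in>F. A u v * f v) = (\<Sum>u\<in>F. \<Sum>v\<in>F. A u v * f v)"
    by (rule sum.swap)
  also have "\<dots> - (\<Sum>u\<in>F. \<Sum>v\<in>F. A u v * f u) = (\<Sum>u\<in>F. \<Sum>v\<in>F. A u v * (f v - f u))"
    by (simp add: sum_subtractf right_diff_distrib)
  also have "\<dots> \<le> (\<Sum>u\<in>F. \<Sum>v\<in>F. A u v * gdist u v)"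
  proof (intro sum_mono mult_left_mono)
    fix u v assume "u \<in> F" "v \<in> F"
    then have "u \<in> pverts D" "v \<in> pverts D"
      using assms(2) by auto
    then show "f v - f u \<le> gdist u v" "0 \<le> A u v"
      using lip[of u v] nonneg by auto
  qed
  finally show "ereal ((\<Sum>v\<in>F. n v * f v) - (\<Sum>u\<in>F. m u * f u)) \<le>
      (\<Sum>\<^sub>\<infinity>(u, v) \<in> pverts D \<times> pverts D. ereal (A u v) * digraph_dist D u v)"
    using coupling_cost_eq[OF assms(1,2) zero] by simp
qed

text \<open>The bound on \<open>m\<close> yields the upper bound \<open>1\<close> that
  \<open>couplings\<close> demands of every entry, since an entry is at most its row sum.\<close>

lemma wasserstein_le_coupling:
  assumes "finite F" "F \<subseteq> pverts D"
    and nonneg: "\<And>u v. 0 \<le> A u v"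
    and zero: "\<And>u v. \<not> (u \<in> F \<and> v \<in> F) \<Longrightarrow> A u v = 0"
    and rows: "\<And>u. u \<in> pverts D \<Longrightarrow> (\<Sum>v\<in>F. A u v) = m u"
    and cols: "\<And>v. v \<in> pverts D \<Longrightarrow> (\<Sum>u\<in>F. A u v) = n v"
    and le_1: "\<And>u. m u \<le> 1"
  shows "wasserstein D m n \<le> ereal (\<Sum>u\<in>F. \<Sum>v\<in>F. A u v * gdist u v)"
proof -
  have "A u v \<le> 1" if "u \<in> pverts D" for u v
  proof (cases "v \<in> F")
    case True
    then have "A u v \<le> (\<Sum>v\<in>F. A u v)"
      using \<open>finite F\<close> nonneg by (intro member_le_sum) auto
    then show ?thesis
      using rows[OF that] le_1[of u] by simp
  qed (simp add: zero)
  moreover have "((\<lambda>v. A u v) has_sum m u) (pverts D)" if "u \<in> pverts D" for u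
    by (rule has_sum_finite_neutralI[OF assms(1,2)]) (use zero rows[OF that] in auto)
  moreover have "((\<lambda>u. A u v) has_sum n v) (pverts D)" if "v \<in> pverts D" for v
    by (rule has_sum_finite_neutralI[OF assms(1,2)]) (use zero cols[OF that] in auto)
  ultimately have "A \<in> couplings D m n"
    using nonneg by (simp add: couplings_def)
  then show ?thesis
    unfolding wasserstein_def
    by (rule INF_lower2) (simp add: coupling_cost_eq[OF assms(1,2) zero])
qed

end

section \<open>The lazy walks at the two ends of the arc\<close>

locale equal_degree_arc = strong_digraph D for D :: "'a pair_pre_digraph" +
  fixes x y :: 'a and r :: nat
  assumes arc: "(x, y) \<in> parcs D"
    and deg: "out_deg D x = r" "out_deg D y = r"
begin

text \<open>With \<open>tgt\<close>, this merges the two cases of the theorem into one assignment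
  problem. When \<open>(y, x)\<close> is an arc, the prescribed pair \<open>w y = x\<close> is
  removed from both sides; otherwise both neighbourhoods stay whole.\<close>

definition src :: "'a set" where
  "src = out_nbrs D x - (if x \<in> out_nbrs D y then {y} else {})"

definition tgt :: "'a set" where
  "tgt = out_nbrs D y - {x}"

definition recip :: real where
  "recip = of_bool (x \<in> out_nbrs D y)"

definition supp :: "'a set" where
  "supp = insert x (insert y (out_nbrs D x \<union> out_nbrs D y))"

definition optimal :: "('a \<Rightarrow> 'a) \<Rightarrow> bool" where
  "optimal w \<longleftrightarrow> bij_betw w src tgt \<and>
     (\<forall>w'. bij_betw w' src tgt \<longrightarrow> (\<Sum>v\<in>src. gdist v (w v)) \<le> (\<Sum>v\<in>src. gdist v (w' v)))"

lemma verts [simp]: "x \<in> pverts D" "y \<in> pverts D"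
  using arc in_arcsD1 in_arcsD2 by auto

lemma y_mem_out_nbrs: "y \<in> out_nbrs D x"
  by (simp add: mem_out_nbrs arc)

lemma r_pos: "0 < r"
  using deg(1) y_mem_out_nbrs finite_out_nbrs[of x] by (auto simp: out_deg_def card_gt_0_iff)

lemma finite_supp: "finite supp"
  by (simp add: supp_def finite_out_nbrs)

lemma supp_subset: "supp \<subseteq> pverts D"
  using out_nbrs_subset by (auto simp: supp_def)

lemma src_subset: "src \<subseteq> supp" and tgt_subset: "tgt \<subseteq> supp"
  by (auto simp: src_def tgt_def supp_def)

lemma finite_src: "finite src" and finite_tgt: "finite tgt"
  using finite_supp src_subset tgt_subset finite_subset by auto

lemma card_src_eq_card_tgt: "card src = card tgt"
  using deg finite_out_nbrs[of x] finite_out_nbrs[of y] y_mem_out_nbrs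
  by (auto simp: src_def tgt_def out_deg_def card_Diff_singleton)

text \<open>Splits off the possible reciprocal neighbour, so that later formulas treat both cases at
  once through \<open>recip\<close>.\<close>

lemma of_bool_out_nbrs_x: "of_bool (v \<in> out_nbrs D x) = (of_bool (v \<in> src) + recip * of_bool (v = y) :: real)"
  using y_mem_out_nbrs by (auto simp: src_def recip_def)

lemma of_bool_out_nbrs_y: "of_bool (v \<in> out_nbrs D y) = (of_bool (v \<in> tgt) + recip * of_bool (v = x) :: real)"
  by (auto simp: tgt_def recip_def)

lemma lazy_walk_x:
  "lazy_walk D \<alpha> x v = \<alpha> * of_bool (v = x) + (1 - \<alpha>) / r * (of_bool (v \<in> src) + recip * of_bool (v = y))"
  by (subst of_bool_out_nbrs_x[symmetric]) (auto simp: lazy_walk_def deg mem_out_nbrs[symmetric])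

lemma lazy_walk_y:
  "lazy_walk D \<alpha> y v = \<alpha> * of_bool (v = y) + (1 - \<alpha>) / r * (of_bool (v \<in> tgt) + recip * of_bool (v = x))"
  by (subst of_bool_out_nbrs_y[symmetric]) (auto simp: lazy_walk_def deg mem_out_nbrs[symmetric])

lemma sum_lazy_walk_x:
  "(\<Sum>v\<in>supp. lazy_walk D \<alpha> x v * f v) = \<alpha> * f x + (1 - \<alpha>) / r * (sum f src + recip * f y)"
proof -
  have "(\<Sum>v\<in>supp. lazy_walk D \<alpha> x v * f v) =
      \<alpha> * (\<Sum>v\<in>supp. of_bool (v = x) * f v) + (1 - \<alpha>) / r *
        ((\<Sum>v\<in>supp. of_bool (v \<in> src) * f v) + recip * (\<Sum>v\<in>supp. of_bool (v = y) * f v))"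
    unfolding lazy_walk_x sum_distrib_left sum.distrib[symmetric]
    by (intro sum.cong refl) (simp add: algebra_simps)
  then show ?thesis
    using sum_of_bool_eq[OF finite_supp, of _ f] sum_of_bool_mem[OF finite_supp src_subset, of f]
    by (simp add: supp_def)
qed

lemma sum_lazy_walk_y:
  "(\<Sum>v\<in>supp. lazy_walk D \<alpha> y v * f v) = \<alpha> * f y + (1 - \<alpha>) / r * (sum f tgt + recip * f x)"
proof -
  have "(\<Sum>v\<in>supp. lazy_walk D \<alpha> y v * f v) =
      \<alpha> * (\<Sum>v\<in>supp. of_bool (v = y) * f v) + (1 - \<alpha>) / r *
        ((\<Sum>v\<in>supp. of_bool (v \<in> tgt) * f v) + recip * (\<Sum>v\<in>supp. of_bool (v = x) * f v))"
    unfolding lazy_walk_y sum_distrib_left sum.distrib[symmetric]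
    by (intro sum.cong refl) (simp add: algebra_simps)
  then show ?thesis
    using sum_of_bool_eq[OF finite_supp, of _ f] sum_of_bool_mem[OF finite_supp tgt_subset, of f]
    by (simp add: supp_def)
qed

section \<open>Matching lower and upper bounds for the transport cost\<close>

text \<open>Tightness on \<open>(x, y)\<close> makes the bulk mass contribute exactly
  \<open>\<alpha>\<close> to the dual value, and the reciprocal masses exactly
  \<open>- recip\<close> per unit of \<open>(1 - \<alpha>) / r\<close>.\<close>

lemma calibrate_potential:
  fixes f :: "'a \<Rightarrow> real"
  assumes lip: "\<And>u v. u \<in> pverts D \<Longrightarrow> v \<in> pverts D \<Longrightarrow> f v \<le> f u + gdist u v"
  obtains g :: "'a \<Rightarrow> real"
  where "\<And>u v. u \<in> pverts D \<Longrightarrow> v \<in> pverts D \<Longrightarrow> g v \<le> g u + gdist u v"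
    and "g y = g x + 1"
    and "sum f tgt - sum f src \<le> sum g tgt - sum g src"
proof -
  \<comment> \<open>Since \<open>f y - 1 \<le> f x\<close>, truncation lowers the value at
    \<open>x\<close> to \<open>f y - 1\<close> and keeps the value at \<open>y\<close>.\<close>
  define g where "g v = min (f v) (f y - 1 + gdist x v)" for v
  have "g v \<le> g u + gdist u v" if "u \<in> pverts D" "v \<in> pverts D" for u v
    using lip[OF that] gdist_triangle[of x u v] that by (simp add: g_def min_def)
  moreover have "g y = g x + 1"
    using lip[of x y] gdist_arc[OF arc] by (simp add: g_def)
  moreover have "sum f tgt - sum f src \<le> sum g tgt - sum g src"
  proof -
    \<comment> \<open>Such a \<open>v\<close> is neither \<open>x\<close> nor an out-neighbour of
      \<open>x\<close>: the only vertex possibly removed from \<open>src\<close> is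
      \<open>y\<close>, which is not its own neighbour. Hence \<open>gdist x v\<close> is at least
      2, while \<open>f v \<le> f y + 1\<close>, and truncation has no effect.\<close>
    have "f v = g v" if "v \<in> tgt - src" for v
    proof -
      have v: "v \<in> pverts D" "(y, v) \<in> parcs D" "v \<noteq> x"
        using that out_nbrs_subset[of y] by (auto simp: tgt_def mem_out_nbrs[symmetric])
      moreover have "v \<notin> out_nbrs D x"
        using that not_mem_out_nbrs_self by (auto simp: src_def tgt_def split: if_splits)
      ultimately have "2 \<le> gdist x v"
        using gdist_le_1_imp_arc[of x v] by (fastforce simp: mem_out_nbrs)
      moreover have "f v \<le> f y + 1"
        using lip[of y v] v gdist_arc[OF v(2)] by simp
      ultimately show ?thesis
        by (simp add: g_def)
    qed
    \<comment> \<open>The loss \<open>f - g\<close> is nonnegative and vanishes on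
      \<open>tgt - src\<close>, so the loss on \<open>tgt\<close> is at most the loss on
      \<open>src\<close>.\<close>
    then have "(\<Sum>v\<in>tgt. f v - g v) = (\<Sum>v\<in>tgt \<inter> src. f v - g v)"
      using finite_tgt by (intro sum.mono_neutral_right) auto
    also have "\<dots> \<le> (\<Sum>v\<in>src. f v - g v)"
      using finite_src by (intro sum_mono2) (auto simp: g_def)
    finally show ?thesis
      by (simp add: sum_subtractf)
  qed
  ultimately show ?thesis
    by (rule that)
qed

lemma wasserstein_lazy_ge:
  assumes "optimal w" "\<alpha> \<le> 1"
  shows "ereal (\<alpha> + (1 - \<alpha>) / r * ((\<Sum>v\<in>src. gdist v (w v)) - recip))
    \<le> wasserstein D (lazy_walk D \<alpha> x) (lazy_walk D \<alpha> y)"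
proof -
  have opt: "(\<Sum>v\<in>src. real (gdist v (w v))) \<le> (\<Sum>v\<in>src. real (gdist v (w' v)))"
    if "bij_betw w' src tgt" for w'
    using assms(1) that by (simp add: optimal_def flip: of_nat_sum)
  have w: "bij_betw w src tgt"
    using assms(1) by (simp add: optimal_def)
  have "src \<subseteq> pverts D" "tgt \<subseteq> pverts D"
    using src_subset tgt_subset supp_subset by auto
  moreover have "real (gdist u z) \<le> real (gdist u v) + real (gdist v z)"
    if "u \<in> pverts D" "v \<in> pverts D" "z \<in> pverts D" for u v z
    using gdist_triangle[OF that] by simp
  ultimately obtain f :: "'a \<Rightarrow> real"
    where f: "\<And>u v. u \<in> pverts D \<Longrightarrow> v \<in> pverts D \<Longrightarrow> f v \<le> f u + gdist u v"
      and tight: "\<And>s. s \<in> src \<Longrightarrow> gdist s (w s) \<le> f (w s) - f s"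
    using optimal_assignment_potential[of src "pverts D" tgt "\<lambda>u v. real (gdist u v)" w]
      finite_src w opt by simp blast
  obtain g :: "'a \<Rightarrow> real"
    where g: "\<And>u v. u \<in> pverts D \<Longrightarrow> v \<in> pverts D \<Longrightarrow> g v \<le> g u + gdist u v"
      and gy: "g y = g x + 1"
      and fg: "sum f tgt - sum f src \<le> sum g tgt - sum g src"
    using calibrate_potential f by blast
  have "(\<Sum>v\<in>src. real (gdist v (w v))) \<le> (\<Sum>v\<in>src. f (w v) - f v)"
    using tight by (intro sum_mono) auto
  also have "\<dots> = sum f tgt - sum f src"
    by (simp add: sum_subtractf sum.reindex_bij_betw[OF w])
  finally have "(\<Sum>v\<in>src. gdist v (w v)) \<le> sum g tgt - sum g src"
    using fg by simp
  then have "\<alpha> + (1 - \<alpha>) / r * ((\<Sum>v\<in>src. gdist v (w v)) - recip) \<le>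
      \<alpha> + (1 - \<alpha>) / r * (sum g tgt - sum g src - recip)"
    using assms(2) by (intro add_left_mono mult_left_mono) auto
  also have "\<dots> = (\<Sum>v\<in>supp. lazy_walk D \<alpha> y v * g v) - (\<Sum>v\<in>supp. lazy_walk D \<alpha> x v * g v)"
    unfolding sum_lazy_walk_x sum_lazy_walk_y gy by (simp add: algebra_simps)
  finally have "\<alpha> + (1 - \<alpha>) / r * ((\<Sum>v\<in>src. gdist v (w v)) - recip) \<le> \<dots>" .
  moreover have "lazy_walk D \<alpha> x v = 0" "lazy_walk D \<alpha> y v = 0" if "v \<in> pverts D - supp" for v
    using that by (auto simp: lazy_walk_def supp_def mem_out_nbrs)
  ultimately show ?thesis
    using wasserstein_ge_dual[OF finite_supp supp_subset _ _ g] order_trans ereal_less_eq(3) by blast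
qed

text \<open>
  If \<open>(y, x)\<close> is an arc, the common mass \<open>(1 - \<alpha>) / r\<close> at \<open>x\<close> and at \<open>y\<close> stays in place instead
  of being exchanged along both arcs.
\<close>
lemma wasserstein_lazy_le:
  assumes w: "bij_betw w src tgt" and \<alpha>: "0 \<le> \<alpha>" "\<alpha> \<le> 1" "(1 - \<alpha>) / r * recip \<le> \<alpha>"
  shows "wasserstein D (lazy_walk D \<alpha> x) (lazy_walk D \<alpha> y)
    \<le> ereal (\<alpha> + (1 - \<alpha>) / r * ((\<Sum>v\<in>src. gdist v (w v)) - recip))"
proof -
  define b where "b = (1 - \<alpha>) / r"
  \<comment> \<open>The four terms are the bulk sent from \<open>x\<close> to \<open>y\<close>, the
    reciprocal mass kept at \<open>x\<close>, the same at \<open>y\<close>, and the mass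
    \<open>b\<close> sent from each \<open>u\<close> in \<open>src\<close> to \<open>w u\<close>.
    The first coefficient is nonnegative by the last assumption on \<open>\<alpha>\<close>.\<close>
  define A where "A u v = (\<alpha> - b * recip) * (of_bool (u = x) * of_bool (v = y))
    + b * recip * (of_bool (u = x) * of_bool (v = x)) + b * recip * (of_bool (u = y) * of_bool (v = y))
    + b * (of_bool (u \<in> src) * of_bool (v = w u))" for u v
  have b: "0 \<le> b" "b * recip \<le> \<alpha>"
    using \<alpha> by (simp_all add: b_def)
  have recip: "0 \<le> recip"
    by (simp add: recip_def)
  have w_mem: "w u \<in> supp" if "u \<in> src" for u
    using that w tgt_subset bij_betwE by blast
  have mem: "x \<in> supp" "y \<in> supp"
    by (simp_all add: supp_def)
  \<comment> \<open>The weight \<open>f\<close> stays general to serve twice: \<open>f = 1\<close>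
    gives the row marginals, and \<open>f = gdist u\<close> gives the cost.\<close>
  have row: "(\<Sum>v\<in>supp. A u v * f v) = (\<alpha> - b * recip) * (of_bool (u = x) * f y)
      + b * recip * (of_bool (u = x) * f x) + b * recip * (of_bool (u = y) * f y)
      + b * (of_bool (u \<in> src) * f (w u))" for u and f :: "'a \<Rightarrow> real"
  proof -
    have "(\<Sum>v\<in>supp. A u v * f v) = (\<alpha> - b * recip) * (of_bool (u = x) * (\<Sum>v\<in>supp. of_bool (v = y) * f v))
      + b * recip * (of_bool (u = x) * (\<Sum>v\<in>supp. of_bool (v = x) * f v))
      + b * recip * (of_bool (u = y) * (\<Sum>v\<in>supp. of_bool (v = y) * f v))
      + b * (of_bool (u \<in> src) * (\<Sum>v\<in>supp. of_bool (v = w u) * f v))"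
      unfolding A_def sum_distrib_left sum.distrib[symmetric]
      by (intro sum.cong refl) (simp add: algebra_simps)
    then show ?thesis
      using sum_of_bool_eq[OF finite_supp, of _ f] mem w_mem by (cases "u \<in> src") simp_all
  qed
  have A_row_sum: "(\<Sum>v\<in>supp. A u v) = lazy_walk D \<alpha> x u" for u
    using row[of u "\<lambda>_. 1"] by (simp add: lazy_walk_x algebra_simps flip: b_def)
  have A_col_sum: "(\<Sum>u\<in>supp. A u v) = lazy_walk D \<alpha> y v" for v
  proof -
    have "(\<Sum>u\<in>supp. of_bool (u \<in> src) * of_bool (v = w u)) = (\<Sum>u\<in>src. of_bool (v = w u) :: real)"
      by (rule sum_of_bool_mem[OF finite_supp src_subset])
    also have "\<dots> = (\<Sum>t\<in>tgt. of_bool (v = t))"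
      by (rule sum.reindex_bij_betw[OF w])
    also have "\<dots> = of_bool (v \<in> tgt)"
      using finite_tgt by (simp add: of_bool_def)
    finally have *: "(\<Sum>u\<in>supp. of_bool (u \<in> src) * of_bool (v = w u)) = (of_bool (v \<in> tgt) :: real)" .
    have "(\<Sum>u\<in>supp. A u v) = (\<alpha> - b * recip) * of_bool (v = y)
      + b * recip * of_bool (v = x) + b * recip * of_bool (v = y) + b * of_bool (v \<in> tgt)"
      unfolding A_def sum.distrib sum_distrib_left[symmetric] *
      using sum_of_bool_eq[OF finite_supp, of _ "\<lambda>_. of_bool (v = x)"]
        sum_of_bool_eq[OF finite_supp, of _ "\<lambda>_. of_bool (v = y)"] mem by simp
    then show ?thesis
      by (simp add: lazy_walk_y algebra_simps flip: b_def)
  qed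
  have "wasserstein D (lazy_walk D \<alpha> x) (lazy_walk D \<alpha> y) \<le> ereal (\<Sum>u\<in>supp. \<Sum>v\<in>supp. A u v * gdist u v)"
  proof (rule wasserstein_le_coupling[OF finite_supp supp_subset])
    show "0 \<le> A u v" for u v
      using b recip by (simp add: A_def)
    show "A u v = 0" if "\<not> (u \<in> supp \<and> v \<in> supp)" for u v
      using that mem w_mem src_subset by (auto simp: A_def)
    show "lazy_walk D \<alpha> x u \<le> 1" for u
    proof (cases "u = x")
      case False
      have "(1 - \<alpha>) / real r \<le> 1"
        using \<alpha> r_pos by (simp add: divide_le_eq)
      with False show ?thesis
        by (simp add: lazy_walk_def deg)
    qed (use \<alpha> in \<open>simp add: lazy_walk_def\<close>)
  qed (simp_all add: A_row_sum A_col_sum)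
  also have "(\<Sum>u\<in>supp. \<Sum>v\<in>supp. A u v * gdist u v) =
      (\<alpha> - b * recip) * (\<Sum>u\<in>supp. of_bool (u = x) * real (gdist u y))
      + b * recip * (\<Sum>u\<in>supp. of_bool (u = x) * real (gdist u x))
      + b * recip * (\<Sum>u\<in>supp. of_bool (u = y) * real (gdist u y))
      + b * (\<Sum>u\<in>supp. of_bool (u \<in> src) * real (gdist u (w u)))"
    unfolding row sum.distrib sum_distrib_left ..
  also have "\<dots> = \<alpha> + b * ((\<Sum>v\<in>src. gdist v (w v)) - recip)"
    using sum_of_bool_mem[OF finite_supp src_subset]
    by (simp add: sum_of_bool_eq finite_supp mem gdist_arc[OF arc] algebra_simps)
  finally show ?thesis
    by (simp add: b_def)
qed

section \<open>The limit and the two curvature formulas\<close>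

text \<open>The transport cost is affine in \<open>\<alpha>\<close> near \<open>1\<close> with value
  \<open>1\<close> at \<open>\<alpha> = 1\<close>, so the quotient is eventually constant.\<close>

lemma lazy_curvature_tendsto:
  assumes "optimal w"
  shows "((\<lambda>\<alpha>. lazy_curvature D \<alpha> x y / ereal (1 - \<alpha>)) \<longlongrightarrow>
    ereal (1 - 1 / r * ((\<Sum>v\<in>src. gdist v (w v)) - recip))) (at_left 1)"
proof (rule tendsto_eventually)
  \<comment> \<open>Above 1/2 one has \<open>1 - \<alpha> \<le> \<alpha>\<close>. With
    \<open>r\<close> at least 1 and \<open>recip\<close> at most 1 this gives the side condition of
    \<open>wasserstein_lazy_le\<close>.\<close>
  have "\<forall>\<^sub>F \<alpha> in at_left 1. \<alpha> \<in> {1/2<..<1::real}"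
    by (rule eventually_at_left_real) simp
  then show "\<forall>\<^sub>F \<alpha> in at_left 1. lazy_curvature D \<alpha> x y / ereal (1 - \<alpha>) =
    ereal (1 - 1 / r * ((\<Sum>v\<in>src. gdist v (w v)) - recip))"
  proof eventually_elim
    case (elim \<alpha>)
    define k where "k = (\<Sum>v\<in>src. gdist v (w v)) - recip"
    have "(1 - \<alpha>) / r * recip \<le> (1 - \<alpha>) / 1 * 1"
      using elim r_pos by (intro mult_mono divide_left_mono) (auto simp: recip_def)
    then have "wasserstein D (lazy_walk D \<alpha> x) (lazy_walk D \<alpha> y) = ereal (\<alpha> + (1 - \<alpha>) / r * k)"
      using assms elim unfolding k_def
      by (intro antisym wasserstein_lazy_le wasserstein_lazy_ge) (auto simp: optimal_def)
    then have "lazy_curvature D \<alpha> x y = ereal (1 - (\<alpha> + (1 - \<alpha>) / r * k))"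
      by (simp add: lazy_curvature_def digraph_dist_eq gdist_arc[OF arc] one_ereal_def)
    moreover have "(1 - (\<alpha> + (1 - \<alpha>) / r * k)) / (1 - \<alpha>) = 1 - 1 / r * k"
      using elim r_pos by (simp add: field_simps)
    ultimately show ?case
      using elim by (simp add: k_def)
  qed
qed

lemma lly_curvature_optimal:
  assumes "optimal w"
  shows "lly_curvature D x y = ereal (1 - 1 / r * ((\<Sum>v\<in>src. gdist v (w v)) - recip))"
  unfolding lly_curvature_def
  using lazy_curvature_tendsto[OF assms] by (rule tendsto_Lim[rotated]) simp

lemma optimal_exists: "\<exists>w. optimal w"
proof -
  obtain w0 where "bij_betw w0 src tgt"
    using finite_same_card_bij[OF finite_src finite_tgt card_src_eq_card_tgt] by blast
  from ex_has_least_nat[of "\<lambda>w. bij_betw w src tgt", OF this, of "\<lambda>w. \<Sum>v\<in>src. gdist v (w v)"]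
  show ?thesis
    by (auto simp: optimal_def)
qed

lemma sum_digraph_dist:
  assumes "bij_betw w src tgt"
  shows "(\<Sum>v\<in>src. digraph_dist D v (w v)) = ereal (\<Sum>v\<in>src. gdist v (w v))"
proof -
  have "(\<Sum>v\<in>src. digraph_dist D v (w v)) = (\<Sum>v\<in>src. ereal (real (gdist v (w v))))"
    using bij_betwE[OF assms] src_subset tgt_subset supp_subset
    by (intro sum.cong refl digraph_dist_eq) blast+
  then show ?thesis
    by simp
qed

lemma lly_curvature_is_arg_min:
  assumes "is_arg_min (\<lambda>w. \<Sum>v\<in>src. digraph_dist D v (w v)) (\<lambda>w. bij_betw w src tgt) w"
  shows "lly_curvature D x y =
    1 - ereal (1 / r) * ((\<Sum>v\<in>src. digraph_dist D v (w v)) - ereal recip)"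
proof -
  have "optimal w"
    using assms
    by (auto simp: optimal_def is_arg_min_def sum_digraph_dist simp del: of_nat_sum simp flip: not_less)
  then show ?thesis
    by (simp add: lly_curvature_optimal sum_digraph_dist optimal_def one_ereal_def)
qed

lemma lly_curvature_no_back_arc:
  assumes "x \<notin> out_nbrs D y"
    and "is_arg_min (\<lambda>w. \<Sum>v\<in>out_nbrs D x. digraph_dist D v (w v))
      (\<lambda>w. bij_betw w (out_nbrs D x) (out_nbrs D y)) w"
  shows "lly_curvature D x y =
    1 - ereal (1 / r) * (\<Sum>v\<in>out_nbrs D x. digraph_dist D v (w v))"
proof -
  have "src = out_nbrs D x" "tgt = out_nbrs D y" "recip = 0"
    using assms(1) by (auto simp: src_def tgt_def recip_def)
  then show ?thesis
    using lly_curvature_is_arg_min[of w] assms(2) by (simp flip: zero_ereal_def)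
qed

text \<open>Bijections sending \<open>y\<close> to \<open>x\<close> restrict to bijections from
  \<open>src\<close> to \<open>tgt\<close>, and every bijection of the latter kind extends. The cost
  ignores \<open>y\<close>, so the two minimisation problems agree.\<close>

lemma lly_curvature_back_arc:
  assumes "x \<in> out_nbrs D y"
    and "is_arg_min (\<lambda>w. \<Sum>v\<in>out_nbrs D x - {y}. digraph_dist D v (w v))
      (\<lambda>w. bij_betw w (out_nbrs D x) (out_nbrs D y) \<and> w y = x) w"
  shows "lly_curvature D x y =
    1 - ereal (1 / r) * ((\<Sum>v\<in>out_nbrs D x - {y}. digraph_dist D v (w v)) - 1)"
proof -
  have src: "src = out_nbrs D x - {y}" and tgt: "tgt = out_nbrs D y - {x}" and "recip = 1"
    using assms(1) by (auto simp: src_def tgt_def recip_def)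
  have nbrs: "out_nbrs D x = insert y src" "out_nbrs D y = insert x tgt" "y \<notin> src" "x \<notin> tgt"
    using assms(1) y_mem_out_nbrs by (auto simp: src tgt)
  have extend: "bij_betw w' (out_nbrs D x) (out_nbrs D y) \<longleftrightarrow> bij_betw w' src tgt" if "w' y = x" for w'
    using notIn_Un_bij_betw3[of y src w' tgt] nbrs that by simp
  have "is_arg_min (\<lambda>w. \<Sum>v\<in>src. digraph_dist D v (w v)) (\<lambda>w. bij_betw w src tgt) w"
    unfolding is_arg_min_def
  proof (intro conjI notI)
    show "bij_betw w src tgt"
      using assms(2) extend by (auto simp: is_arg_min_def)
    assume "\<exists>w'. bij_betw w' src tgt \<and>
      (\<Sum>v\<in>src. digraph_dist D v (w' v)) < (\<Sum>v\<in>src. digraph_dist D v (w v))"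
    then obtain w' where w': "bij_betw w' src tgt"
      "(\<Sum>v\<in>src. digraph_dist D v (w' v)) < (\<Sum>v\<in>src. digraph_dist D v (w v))"
      by blast
    \<comment> \<open>A competitor on \<open>src\<close> may take any value at \<open>y\<close>;
      resetting it to \<open>x\<close> makes it admissible at the same cost.\<close>
    define w'' where "w'' = w'(y := x)"
    have eq: "w'' v = w' v" if "v \<in> src" for v
      using that nbrs(3) by (auto simp: w''_def)
    have "w'' y = x"
      by (simp add: w''_def)
    moreover have "bij_betw w'' src tgt"
      using w'(1) bij_betw_cong[of src w'' w'] eq by blast
    moreover have "(\<Sum>v\<in>src. digraph_dist D v (w'' v)) = (\<Sum>v\<in>src. digraph_dist D v (w' v))"
      using eq by simp
    ultimately show False
      using assms(2) w'(2) extend[of w''] by (auto simp: is_arg_min_def src)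
  qed
  from lly_curvature_is_arg_min[OF this] show ?thesis
    using \<open>recip = 1\<close> by (simp add: src one_ereal_def)
qed

end

theorem theorem3p1:
  fixes D :: "'a pair_pre_digraph" and x y :: 'a and r :: nat
  assumes "pair_loopfree_digraph D"
    and "strongly_connected (with_proj D)"
    and "locally_finite D"
    and "(x, y) \<in> parcs D"
    and "out_deg D x = r" and "out_deg D y = r"
  shows "((\<lambda>\<alpha>. lazy_curvature D \<alpha> x y / ereal (1 - \<alpha>)) \<longlongrightarrow> lly_curvature D x y) (at_left 1) \<and>
    (x \<notin> out_nbrs D y \<longrightarrow>
      (\<forall>w. is_arg_min (\<lambda>w. \<Sum>v \<in> out_nbrs D x. digraph_dist D v (w v))
             (\<lambda>w. bij_betw w (out_nbrs D x) (out_nbrs D y)) w \<longrightarrow>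
           lly_curvature D x y =
             1 - ereal (1 / real r) * (\<Sum>v \<in> out_nbrs D x. digraph_dist D v (w v)))) \<and>
    (x \<in> out_nbrs D y \<longrightarrow>
      (\<forall>w. is_arg_min (\<lambda>w. \<Sum>v \<in> out_nbrs D x - {y}. digraph_dist D v (w v))
             (\<lambda>w. bij_betw w (out_nbrs D x) (out_nbrs D y) \<and> w y = x) w \<longrightarrow>
           lly_curvature D x y =
             1 - ereal (1 / real r) *
               ((\<Sum>v \<in> out_nbrs D x - {y}. digraph_dist D v (w v)) - 1)))"
proof -
  interpret equal_degree_arc D x y r
    using assms
    by (simp add: equal_degree_arc_def equal_degree_arc_axioms_def strong_digraph_def
        strong_digraph_axioms_def)
  \<comment> \<open>\<open>Lim\<close> denotes the limit only if one exists, so convergence is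
    proved for an optimal assignment obtained here, independently of the \<open>w\<close> quantified
    in the formulas.\<close>
  obtain w where "optimal w"
    using optimal_exists by blast
  then have "((\<lambda>\<alpha>. lazy_curvature D \<alpha> x y / ereal (1 - \<alpha>)) \<longlongrightarrow> lly_curvature D x y) (at_left 1)"
    using lazy_curvature_tendsto lly_curvature_optimal by simp
  then show ?thesis
    using lly_curvature_no_back_arc lly_curvature_back_arc by blast
qed

end
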